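(* Let $E$ be a set of parameters, let $(X,\tau,E)$ be a soft topological space and let $\{(Y_s,\tau'_s,E)\}_{s\in S}$ be a family of soft topological spaces, all over the same parameter set $E$. Let $(Y_s^X,\tau'_{s_p},E)$ be the pointwise soft function space of soft continuous mappings from $(X,\tau,E)$ to $(Y_s,\tau'_s,E)$, and let $\left(\left(\prod_{s\in S}Y_s\right)^X,\left(\prod_{s\in S}\tau'_s\right)_p,E\right)$ be the pointwise soft function space of soft continuous mappings from $(X,\tau,E)$ to the product soft topological space $\left(\prod_{s\in S}Y_s,\prod_{s\in S}\tau'_s,E\right)$. Then the mapping $$\Delta:\prod_{s\in S}\left(Y_s^X,\tau'_{s_p},E\right)\to\left(\left(\prod_{s\in S}Y_s\right)^X,\left(\prod_{s\in S}\tau'_s\right)_p,E\right),\qquad \Delta(\{f_s\}_{s\in S})(x_\alpha)=\{f_s(x_\alpha)\}_{s\in S}=\{(f_s(x))_\alpha\}_{s\in S},$$ is a soft homeomorphism, where the left-hand side carries the product soft topology.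
   Context: Soft sets: a soft set $(F,E)$ over a set $X$ is a map $F:E\to P(X)$ into the power set of $X$. Inclusions, unions and intersections of soft sets with the same parameter set $E$ are taken parameterwise: $(F,E)\subset(G,E)$ means $F(e)\subset G(e)$ for all $e\in E$, and $(F\cup G)(e)=F(e)\cup G(e)$, $(F\cap G)(e)=F(e)\cap G(e)$, similarly for arbitrary families. $\Phi$ is the soft set with $\Phi(e)=\varnothing$ for all $e\in E$, and $\widetilde X$ is the soft set with $\widetilde X(e)=X$ for all $e\in E$. Soft topology: a soft topology on $X$ (with parameter set $E$) is a collection $\tau$ of soft sets $(F,E)$ over $X$ that contains $\Phi$ and $\widetilde X$ and is closed under arbitrary unions and under intersections of two members; $(X,\tau,E)$ is then a soft topological space and the members of $\tau$ are its soft open sets. A subbase of $\tau$ is a subcollection whose finite intersections form a base, i.e. every member of $\tau$ is a union of such finite intersections. Soft points: for $x\in X$, $e\in E$, the soft point $x_e$ is the soft set with value $\{x\}$ at $e$ and $\varnothing$ at all other parameters; $x_e\in(F,E)$ means $x\in F(e)$. A soft set $(F,E)$ is a soft neighbourhood of $x_e$ if there is a soft open $(G,E)$ with $x_e\in(G,E)\subset(F,E)$. Soft mappings: a soft mapping $f=(f,1_E):(X,\tau,E)\to(Y,\tau',E)$ is given by a map $f:X\to Y$ together with the identity of $E$; it sends $x_e$ to $f(x)_e$, the image of $(F,E)$ is $e\mapsto f(F(e))$ and the preimage of $(G,E)$ is $e\mapsto f^{-1}(G(e))$. It is soft continuous if for every soft point $x_e$ of $X$ and every soft neighbourhood $(H,E)$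 of $f(x)_e$ there is a soft neighbourhood $(F,E)$ of $x_e$ with $f((F,E))\subset(H,E)$. A soft homeomorphism is a soft mapping given by a bijection such that it and its inverse are soft continuous. Product: the product of soft topological spaces $\{(Z_s,\eta_s,E)\}_{s\in S}$ is $\prod_{s\in S}Z_s$ with parameter set $E$ and the soft topology $\prod_{s\in S}\eta_s$ having as subbase all soft sets $e\mapsto F_{s_0}(e)\times\prod_{s\neq s_0}Z_s$, for $s_0\in S$ and $(F_{s_0},E)\in\eta_{s_0}$. A soft point $z_\alpha$ of the product, $z=\{z_s\}_{s\in S}$, is also written $\{(z_s)_\alpha\}_{s\in S}$; thus $\Delta(\{f_s\})$ is the soft mapping $x\mapsto\{f_s(x)\}_{s\in S}$. Function space: for soft topological spaces $(X,\tau,E)$, $(Y,\tau',E)$, $Y^X$ denotes the set of all soft continuous mappings $(f,1_E):(X,\tau,E)\to(Y,\tau',E)$. For a soft point $x_\alpha$ of $X$ the evaluation map $e_{x_\alpha}:(Y^X,E)\to(Y,\tau',E)$ is the soft mapping given by $f\mapsto f(x)$ and the identity on $E$, so that $e_{x_\alpha}^{-1}(G,E)$ is the soft set $e\mapsto\{f\in Y^X: f(x)\in G(e)\}$ over $Y^X$. The pointwise soft topology $\tau'_p$ on $Y^X$ is the soft topology with subbase $\{e_{x_\alpha}^{-1}(G,E): x\in X,\ \alpha\in E,\ (G,E)\in\tau'\}$, and $(Y^X,\tau'_p,E)$ is called the pointwise soft function space. *)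

theory Defs
  imports Main "HOL-Library.FuncSet"
begin

text \<open>
  A soft set over \<open>X\<close> with parameter set \<open>E\<close> is a map from \<open>E\<close> to the subsets of \<open>X\<close>, represented
  by a total function with value \<open>{}\<close> outside \<open>E\<close>. With this convention the parameterwise inclusion,
  union and intersection, and the soft set \<open>\<Phi>\<close>, are the library's pointwise lattice operations
  \<open>\<le>\<close>, \<open>sup\<close> / \<open>Sup\<close>, \<open>inf\<close> / \<open>Inf\<close> and \<open>bot\<close> on functions into sets. The one exception is the
  intersection of the empty family, which is \<open>soft_whole X E\<close> rather than \<open>top\<close>.
\<close>

type_synonym ('e, 'a) soft = "'e \<Rightarrow> 'a set"

definition soft_sets :: "'a set \<Rightarrow> 'e set \<Rightarrow> ('e, 'a) soft set" where
  "soft_sets X E = {F. (\<forall>e\<in>E. F e \<subseteq> X) \<and> (\<forall>e. e \<notin> E \<longrightarrow> F e = {})}"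

definition soft_whole :: "'a set \<Rightarrow> 'e set \<Rightarrow> ('e, 'a) soft" where
  "soft_whole X E = (\<lambda>e. if e \<in> E then X else {})"

definition soft_topology :: "'a set \<Rightarrow> 'e set \<Rightarrow> ('e, 'a) soft set \<Rightarrow> bool" where
  "soft_topology X E \<tau> \<longleftrightarrow>
     \<tau> \<subseteq> soft_sets X E \<and> bot \<in> \<tau> \<and> soft_whole X E \<in> \<tau> \<and>
     (\<forall>U. U \<subseteq> \<tau> \<longrightarrow> Sup U \<in> \<tau>) \<and>
     (\<forall>F\<in>\<tau>. \<forall>G\<in>\<tau>. inf F G \<in> \<tau>)"

definition soft_finite_inters :: "'a set \<Rightarrow> 'e set \<Rightarrow> ('e, 'a) soft set \<Rightarrow> ('e, 'a) soft set" where
  "soft_finite_inters X E B = {inf (soft_whole X E) (Inf A) | A. finite A \<and> A \<subseteq> B}"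

definition soft_subbase ::
    "'a set \<Rightarrow> 'e set \<Rightarrow> ('e, 'a) soft set \<Rightarrow> ('e, 'a) soft set \<Rightarrow> bool" where
  "soft_subbase X E \<tau> B \<longleftrightarrow>
     B \<subseteq> \<tau> \<and> (\<forall>F\<in>\<tau>. \<exists>U. U \<subseteq> soft_finite_inters X E B \<and> F = Sup U)"

text \<open>
  The soft topology with subbase \<open>B\<close>. The lemmas \<open>soft_topology_generated\<close>,
  \<open>soft_subbase_generated\<close> and \<open>soft_generated_unique\<close> below show that, for a family \<open>B\<close> of soft
  sets over \<open>X\<close>, it is the unique soft topology on \<open>X\<close> having \<open>B\<close> as a subbase.
\<close>

definition soft_generated :: "'a set \<Rightarrow> 'e set \<Rightarrow> ('e, 'a) soft set \<Rightarrow> ('e, 'a) soft set" where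
  "soft_generated X E B = {Sup U | U. U \<subseteq> soft_finite_inters X E B}"

text \<open>A soft point \<open>x\<^sub>e\<close> is given by the pair of \<open>x\<close> and \<open>e\<close>; it belongs to \<open>F\<close> iff \<open>x \<in> F e\<close>.\<close>

definition soft_nhd ::
    "'a set \<Rightarrow> 'e set \<Rightarrow> ('e, 'a) soft set \<Rightarrow> 'a \<Rightarrow> 'e \<Rightarrow> ('e, 'a) soft \<Rightarrow> bool" where
  "soft_nhd X E \<tau> x e F \<longleftrightarrow> F \<in> soft_sets X E \<and> (\<exists>G\<in>\<tau>. x \<in> G e \<and> G \<le> F)"

text \<open>
  A soft mapping \<open>(f, 1\<^sub>E)\<close> is given by its underlying map \<open>f\<close>, of which only the values on the
  domain \<open>X\<close> matter.
\<close>

definition soft_image :: "('a \<Rightarrow> 'b) \<Rightarrow> ('e, 'a) soft \<Rightarrow> ('e, 'b) soft" where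
  "soft_image f F = (\<lambda>e. f ` F e)"

definition soft_preimage :: "'a set \<Rightarrow> ('a \<Rightarrow> 'b) \<Rightarrow> ('e, 'b) soft \<Rightarrow> ('e, 'a) soft" where
  "soft_preimage X f G = (\<lambda>e. {x \<in> X. f x \<in> G e})"

definition soft_continuous ::
    "'e set \<Rightarrow> 'a set \<Rightarrow> ('e, 'a) soft set \<Rightarrow> 'b set \<Rightarrow> ('e, 'b) soft set \<Rightarrow> ('a \<Rightarrow> 'b) \<Rightarrow> bool" where
  "soft_continuous E X \<tau> Y \<tau>' f \<longleftrightarrow>
     f \<in> X \<rightarrow> Y \<and>
     (\<forall>x\<in>X. \<forall>e\<in>E. \<forall>H. soft_nhd Y E \<tau>' (f x) e H \<longrightarrow>
        (\<exists>F. soft_nhd X E \<tau> x e F \<and> soft_image f F \<le> H))"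

definition soft_homeomorphism ::
    "'e set \<Rightarrow> 'a set \<Rightarrow> ('e, 'a) soft set \<Rightarrow> 'b set \<Rightarrow> ('e, 'b) soft set \<Rightarrow> ('a \<Rightarrow> 'b) \<Rightarrow> bool" where
  "soft_homeomorphism E X \<tau> Y \<tau>' f \<longleftrightarrow>
     bij_betw f X Y \<and> soft_continuous E X \<tau> Y \<tau>' f \<and>
     soft_continuous E Y \<tau>' X \<tau> (inv_into X f)"

definition soft_product_topology ::
    "'e set \<Rightarrow> 's set \<Rightarrow> ('s \<Rightarrow> 'z set) \<Rightarrow> ('s \<Rightarrow> ('e, 'z) soft set) \<Rightarrow> ('e, 's \<Rightarrow> 'z) soft set" where
  "soft_product_topology E S Z \<eta> =
     soft_generated (Pi\<^sub>E S Z) E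
       {(\<lambda>e. Pi\<^sub>E S (\<lambda>s. if s = s0 then F e else Z s)) | s0 F. s0 \<in> S \<and> F \<in> \<eta> s0}"

text \<open>
  The set \<open>Y\<^sup>X\<close>. Its elements are extensional functions (\<open>undefined\<close> outside \<open>X\<close>), so that equality
  is equality of maps from \<open>X\<close> to \<open>Y\<close>.
\<close>

definition soft_funspace ::
    "'e set \<Rightarrow> 'a set \<Rightarrow> ('e, 'a) soft set \<Rightarrow> 'b set \<Rightarrow> ('e, 'b) soft set \<Rightarrow> ('a \<Rightarrow> 'b) set" where
  "soft_funspace E X \<tau> Y \<tau>' = {f \<in> X \<rightarrow>\<^sub>E Y. soft_continuous E X \<tau> Y \<tau>' f}"

text \<open>
  The evaluation map at a soft point \<open>x\<^sub>\<alpha>\<close> has underlying map \<open>f \<mapsto> f x\<close>, whatever \<open>\<alpha>\<close> is; the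
  parameter is kept in the subbase only to range over the soft points of \<open>X\<close>.
\<close>

definition soft_eval :: "'a \<Rightarrow> 'e \<Rightarrow> ('a \<Rightarrow> 'b) \<Rightarrow> 'b" where
  "soft_eval x \<alpha> = (\<lambda>f. f x)"

definition soft_pointwise_topology ::
    "'e set \<Rightarrow> 'a set \<Rightarrow> ('e, 'a) soft set \<Rightarrow> 'b set \<Rightarrow> ('e, 'b) soft set \<Rightarrow>
     ('e, 'a \<Rightarrow> 'b) soft set" where
  "soft_pointwise_topology E X \<tau> Y \<tau>' =
     soft_generated (soft_funspace E X \<tau> Y \<tau>') E
       {soft_preimage (soft_funspace E X \<tau> Y \<tau>') (soft_eval x \<alpha>) G | x \<alpha> G.
          x \<in> X \<and> \<alpha> \<in> E \<and> G \<in> \<tau>'}"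

definition soft_Delta :: "'a set \<Rightarrow> 's set \<Rightarrow> ('s \<Rightarrow> 'a \<Rightarrow> 'b) \<Rightarrow> 'a \<Rightarrow> 's \<Rightarrow> 'b" where
  "soft_Delta X S f = (\<lambda>x\<in>X. \<lambda>s\<in>S. f s x)"

lemma soft_sets_le_whole: "F \<in> soft_sets X E \<longleftrightarrow> F \<le> soft_whole X E"
  by (auto simp: soft_sets_def soft_whole_def le_fun_def split: if_splits)

lemma soft_finite_inters_inf:
  assumes "F \<in> soft_finite_inters X E B" and "G \<in> soft_finite_inters X E B"
  shows "inf F G \<in> soft_finite_inters X E B"
proof -
  obtain A where A: "finite A" "A \<subseteq> B" "F = inf (soft_whole X E) (Inf A)"
    using assms(1) unfolding soft_finite_inters_def by blast
  obtain A' where A': "finite A'" "A' \<subseteq> B" "G = inf (soft_whole X E) (Inf A')"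
    using assms(2) unfolding soft_finite_inters_def by blast
  have "inf F G = inf (soft_whole X E) (Inf (A \<union> A'))"
    unfolding A(3) A'(3) Inf_union_distrib by (simp add: inf_aci)
  then show ?thesis
    unfolding soft_finite_inters_def using A A' by blast
qed

lemma soft_topology_generated: "soft_topology X E (soft_generated X E B)"
  unfolding soft_topology_def
proof (intro conjI allI impI ballI)
  show "soft_generated X E B \<subseteq> soft_sets X E"
  proof
    fix F assume "F \<in> soft_generated X E B"
    then obtain U where U: "U \<subseteq> soft_finite_inters X E B" "F = Sup U"
      unfolding soft_generated_def by blast
    have "G \<le> soft_whole X E" if "G \<in> U" for G
      using that U(1) unfolding soft_finite_inters_def by auto
    then show "F \<in> soft_sets X E"
      unfolding U(2) soft_sets_le_whole by (rule Sup_least)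
  qed
  show "bot \<in> soft_generated X E B"
    unfolding soft_generated_def by (auto intro!: exI[of _ "{}"])
  have "soft_whole X E \<in> soft_finite_inters X E B"
    unfolding soft_finite_inters_def by (auto intro!: exI[of _ "{}"])
  then show "soft_whole X E \<in> soft_generated X E B"
    unfolding soft_generated_def by (auto intro!: exI[of _ "{soft_whole X E}"])
next
  fix V assume V: "V \<subseteq> soft_generated X E B"
  define U where "U = {G \<in> soft_finite_inters X E B. G \<le> Sup V}"
  have "F \<le> Sup U" if F: "F \<in> V" for F
  proof -
    obtain W where W: "W \<subseteq> soft_finite_inters X E B" "F = Sup W"
      using F V unfolding soft_generated_def by blast
    have "G \<in> U" if "G \<in> W" for G
    proof -
      have "G \<le> F" using that W(2) by (simp add: Sup_upper)
      also have "F \<le> Sup V" using F by (rule Sup_upper)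
      finally show ?thesis using that W(1) unfolding U_def by blast
    qed
    then show ?thesis unfolding W(2) by (intro Sup_subset_mono) blast
  qed
  then have "Sup V = Sup U"
    by (intro antisym Sup_least) (auto simp: U_def)
  moreover have "U \<subseteq> soft_finite_inters X E B" unfolding U_def by blast
  ultimately show "Sup V \<in> soft_generated X E B"
    unfolding soft_generated_def by blast
next
  fix F G assume "F \<in> soft_generated X E B" "G \<in> soft_generated X E B"
  then obtain U V where U: "U \<subseteq> soft_finite_inters X E B" "F = Sup U"
    and V: "V \<subseteq> soft_finite_inters X E B" "G = Sup V"
    unfolding soft_generated_def by blast
  define W where "W = {inf H K | H K. H \<in> U \<and> K \<in> V}"
  have "W \<subseteq> soft_finite_inters X E B"
    unfolding W_def using U(1) V(1) soft_finite_inters_inf by blast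
  moreover have "inf F G = Sup W"
  proof
    fix e
    show "inf F G e = Sup W e"
      unfolding U(2) V(2) W_def by (fastforce simp: Sup_fun_def)
  qed
  ultimately show "inf F G \<in> soft_generated X E B"
    unfolding soft_generated_def by blast
qed

lemma soft_subbase_generated:
  assumes "B \<subseteq> soft_sets X E"
  shows "soft_subbase X E (soft_generated X E B) B"
  unfolding soft_subbase_def
proof (intro conjI ballI)
  show "B \<subseteq> soft_generated X E B"
  proof
    fix F assume F: "F \<in> B"
    then have "F = inf (soft_whole X E) (Inf {F})"
      using assms by (auto simp: soft_sets_le_whole inf_absorb2)
    then have "F \<in> soft_finite_inters X E B"
      unfolding soft_finite_inters_def using F by blast
    then show "F \<in> soft_generated X E B"
      unfolding soft_generated_def by (auto intro!: exI[of _ "{F}"])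
  qed
qed (auto simp: soft_generated_def)

lemma soft_generated_unique:
  assumes "soft_topology X E \<tau>" and "soft_subbase X E \<tau> B"
  shows "\<tau> = soft_generated X E B"
proof
  show "\<tau> \<subseteq> soft_generated X E B"
    using assms(2) unfolding soft_subbase_def soft_generated_def by blast
  have "inf (soft_whole X E) (Inf A) \<in> \<tau>" if "finite A" "A \<subseteq> B" for A
    using that
  proof (induction A)
    case empty
    then show ?case using assms(1) by (simp add: soft_topology_def)
  next
    case (insert F A)
    then have "inf F (inf (soft_whole X E) (Inf A)) \<in> \<tau>"
      using assms unfolding soft_topology_def soft_subbase_def by blast
    then show ?case unfolding Inf_insert by (simp only: inf_left_commute)
  qed
  then have "soft_finite_inters X E B \<subseteq> \<tau>"
    unfolding soft_finite_inters_def by blast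
  then show "soft_generated X E B \<subseteq> \<tau>"
    using assms(1) unfolding soft_generated_def soft_topology_def by blast
qed

end

theory Submission
  imports Defs
begin

text \<open>
  Soft continuity amounts to preimages of soft open sets being soft open, and for a generated
  topology it is enough to look at a subbase (\<open>soft_continuous_iff_preimage\<close>,
  \<open>soft_continuous_into_generated\<close>). Both the product topology and the pointwise topology are
  generated by the preimages of soft open sets under a family of maps, the projections and the
  evaluations respectively, so each has the universal property of an initial topology: a map into
  it is soft continuous once its composites with that family are
  (\<open>soft_continuous_into_product\<close>, \<open>soft_continuous_into_pointwise\<close>).

  The theorem then is the exchange of two arguments. The universal property of the product,
  together with soft continuity of the projections, says that \<open>g\<close> is a soft continuous map into
  the product exactly when all \<open>\<lambda>x. g x s\<close> are soft continuous; hence \<open>\<Delta>\<close> and the exchange in the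
  opposite direction, \<open>g \<mapsto> (\<lambda>s x. g x s)\<close>, map into the right function spaces, and they are
  mutually inverse. The composite of \<open>\<Delta>\<close> with the evaluation at \<open>x\<close> and the projection to \<open>s\<close> is
  the projection to \<open>s\<close> followed by the evaluation at \<open>x\<close>, so it is soft continuous, and the same
  computation read backwards works for the inverse.
\<close>

section \<open>Soft continuity through preimages\<close>

lemma soft_topology_soft_sets: "soft_topology X E \<tau> \<Longrightarrow> F \<in> \<tau> \<Longrightarrow> F \<in> soft_sets X E"
  unfolding soft_topology_def by blast

lemma soft_topology_finite_inter:
  assumes "soft_topology X E \<tau>" and "finite A" and "A \<subseteq> \<tau>"
  shows "inf (soft_whole X E) (Inf A) \<in> \<tau>"
  using assms(2,3)
proof (induction A)
  case empty
  then show ?case using assms(1) by (simp add: soft_topology_def)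
next
  case (insert F A)
  then have "inf F (inf (soft_whole X E) (Inf A)) \<in> \<tau>"
    using assms(1) unfolding soft_topology_def by blast
  then show ?case unfolding Inf_insert by (simp only: inf_left_commute)
qed

text \<open>
  As in ordinary topology, a soft set is the union of the soft open sets below it as soon as each of
  its soft points has a soft open set around it inside the soft set.
\<close>

lemma soft_open_if_nhd_of_points:
  assumes \<tau>: "soft_topology X E \<tau>"
    and "\<And>x e. x \<in> F e \<Longrightarrow> \<exists>G\<in>\<tau>. x \<in> G e \<and> G \<le> F"
  shows "F \<in> \<tau>"
proof -
  have "F \<le> Sup {G \<in> \<tau>. G \<le> F}"
  proof (intro le_funI subsetI)
    fix e x assume "x \<in> F e"
    then obtain G where G: "G \<in> \<tau>" "x \<in> G e" "G \<le> F" using assms(2) by blast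
    then have "G \<le> Sup {G \<in> \<tau>. G \<le> F}" by (intro Sup_upper) blast
    then show "x \<in> Sup {G \<in> \<tau>. G \<le> F} e" using G(2) by (blast dest: le_funD)
  qed
  moreover have "Sup {G \<in> \<tau>. G \<le> F} \<le> F" by (rule Sup_least) blast
  moreover have "Sup {G \<in> \<tau>. G \<le> F} \<in> \<tau>"
    using \<tau> by (simp add: soft_topology_def)
  ultimately show ?thesis by (metis antisym)
qed

text \<open>
  A soft point of the preimage of a soft open set has, by the neighbourhood form of soft continuity,
  a neighbourhood that maps into that set and so lies in the preimage. Conversely the preimage of an
  open set inside a given neighbourhood of the image point is the neighbourhood required.
\<close>

lemma soft_continuous_iff_preimage:
  assumes \<tau>: "soft_topology X E \<tau>" and \<tau>': "soft_topology Y E \<tau>'"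
  shows "soft_continuous E X \<tau> Y \<tau>' f \<longleftrightarrow>
    f \<in> X \<rightarrow> Y \<and> (\<forall>G\<in>\<tau>'. soft_preimage X f G \<in> \<tau>)"
proof (intro iffI conjI ballI)
  assume f: "soft_continuous E X \<tau> Y \<tau>' f"
  then show "f \<in> X \<rightarrow> Y" unfolding soft_continuous_def by blast
  fix G assume G: "G \<in> \<tau>'"
  have Gs: "G \<in> soft_sets Y E" using \<tau>' G by (rule soft_topology_soft_sets)
  show "soft_preimage X f G \<in> \<tau>"
  proof (rule soft_open_if_nhd_of_points[OF \<tau>])
    fix x e assume "x \<in> soft_preimage X f G e"
    then have x: "x \<in> X" "f x \<in> G e" by (auto simp: soft_preimage_def)
    then have e: "e \<in> E" using Gs by (auto simp: soft_sets_def)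
    have "soft_nhd Y E \<tau>' (f x) e G" using Gs G x by (auto simp: soft_nhd_def)
    then obtain F where F: "soft_nhd X E \<tau> x e F" "soft_image f F \<le> G"
      using f x e unfolding soft_continuous_def by blast
    then obtain K where K: "K \<in> \<tau>" "x \<in> K e" "K \<le> F" unfolding soft_nhd_def by blast
    have "y \<in> soft_preimage X f G e'" if y: "y \<in> K e'" for y e'
    proof -
      have "y \<in> F e'" using y K(3) by (auto dest: le_funD)
      then have "f y \<in> G e'" using F(2) by (auto simp: soft_image_def le_fun_def)
      moreover have "y \<in> X"
        using soft_topology_soft_sets[OF \<tau> K(1)] y by (cases "e' \<in> E") (auto simp: soft_sets_def)
      ultimately show ?thesis by (simp add: soft_preimage_def)
    qed
    then have "K \<le> soft_preimage X f G" by (auto simp: le_fun_def)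
    then show "\<exists>K\<in>\<tau>. x \<in> K e \<and> K \<le> soft_preimage X f G" using K by blast
  qed
next
  assume f: "f \<in> X \<rightarrow> Y \<and> (\<forall>G\<in>\<tau>'. soft_preimage X f G \<in> \<tau>)"
  show "soft_continuous E X \<tau> Y \<tau>' f"
    unfolding soft_continuous_def
  proof (intro conjI ballI allI impI)
    show "f \<in> X \<rightarrow> Y" using f by blast
    fix x e H assume x: "x \<in> X" and "e \<in> E" and "soft_nhd Y E \<tau>' (f x) e H"
    then obtain G where G: "G \<in> \<tau>'" "f x \<in> G e" "G \<le> H" unfolding soft_nhd_def by blast
    define F where "F = soft_preimage X f G"
    have F: "F \<in> \<tau>" using f G(1) unfolding F_def by blast
    have "x \<in> F e" using x G(2) by (simp add: F_def soft_preimage_def)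
    then have "soft_nhd X E \<tau> x e F"
      using soft_topology_soft_sets[OF \<tau> F] F unfolding soft_nhd_def by blast
    moreover have "soft_image f F \<le> H"
      using G(3) by (auto simp: F_def soft_image_def soft_preimage_def le_fun_def)
    ultimately show "\<exists>F. soft_nhd X E \<tau> x e F \<and> soft_image f F \<le> H" by blast
  qed
qed

text \<open>
  Every generated soft open set is a union of finite intersections of members of the subbase, and
  taking preimages commutes with both operations. The empty intersection causes no exception: it is
  the whole soft set over \<open>Y\<close>, whose preimage is the whole soft set over \<open>X\<close> because \<open>f\<close> maps \<open>X\<close>
  into \<open>Y\<close>.
\<close>

lemma soft_continuous_into_generated:
  assumes \<tau>: "soft_topology X E \<tau>" and f: "f \<in> X \<rightarrow> Y"
    and B: "\<And>G. G \<in> B \<Longrightarrow> soft_preimage X f G \<in> \<tau>"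
  shows "soft_continuous E X \<tau> Y (soft_generated Y E B) f"
  unfolding soft_continuous_iff_preimage[OF \<tau> soft_topology_generated]
proof (intro conjI ballI)
  fix G assume "G \<in> soft_generated Y E B"
  then obtain U where U: "U \<subseteq> soft_finite_inters Y E B" "G = Sup U"
    unfolding soft_generated_def by blast
  have "soft_preimage X f H \<in> \<tau>" if "H \<in> U" for H
  proof -
    obtain A where A: "finite A" "A \<subseteq> B" "H = inf (soft_whole Y E) (Inf A)"
      using \<open>H \<in> U\<close> U(1) unfolding soft_finite_inters_def by blast
    have "soft_preimage X f H = inf (soft_whole X E) (Inf (soft_preimage X f ` A))"
    proof
      fix e
      show "soft_preimage X f H e = inf (soft_whole X E) (Inf (soft_preimage X f ` A)) e"
        using f unfolding A(3)
        by (auto simp: soft_preimage_def soft_whole_def split: if_splits)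
    qed
    moreover have "soft_preimage X f ` A \<subseteq> \<tau>" using A(2) B by blast
    ultimately show ?thesis using soft_topology_finite_inter[OF \<tau>] A(1) by simp
  qed
  then have "soft_preimage X f ` U \<subseteq> \<tau>" by (rule image_subsetI)
  then have "Sup (soft_preimage X f ` U) \<in> \<tau>"
    using \<tau> by (simp add: soft_topology_def)
  moreover have "soft_preimage X f G = Sup (soft_preimage X f ` U)"
    unfolding U(2) soft_preimage_def by (rule ext) auto
  ultimately show "soft_preimage X f G \<in> \<tau>" by simp
qed (rule f)

text \<open>
  The set-theoretic inverse and the restrictions to \<open>X\<close> that make maps extensional take their
  intended values only on the domain; this carries soft continuity over to them.
\<close>

lemma soft_continuous_cong:
  assumes "\<And>x. x \<in> X \<Longrightarrow> f x = g x"
    and \<tau>: "soft_topology X E \<tau>" and \<tau>': "soft_topology Y E \<tau>'"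
  shows "soft_continuous E X \<tau> Y \<tau>' f \<longleftrightarrow> soft_continuous E X \<tau> Y \<tau>' g"
proof -
  have "soft_preimage X f G = soft_preimage X g G" if "G \<in> \<tau>'" for G
    using assms(1) by (auto simp: soft_preimage_def fun_eq_iff)
  moreover have "f \<in> X \<rightarrow> Y \<longleftrightarrow> g \<in> X \<rightarrow> Y" using assms(1) by (auto simp: Pi_iff)
  ultimately show ?thesis by (simp add: soft_continuous_iff_preimage[OF \<tau> \<tau>'])
qed

lemma soft_continuous_compose:
  assumes f: "soft_continuous E X \<tau> Y \<tau>' f" and g: "soft_continuous E Y \<tau>' Z \<tau>'' g"
    and \<tau>: "soft_topology X E \<tau>" and \<tau>': "soft_topology Y E \<tau>'"
    and \<tau>'': "soft_topology Z E \<tau>''"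
  shows "soft_continuous E X \<tau> Z \<tau>'' (\<lambda>x. g (f x))"
proof -
  have fm: "f \<in> X \<rightarrow> Y" and gm: "g \<in> Y \<rightarrow> Z"
    using f g unfolding soft_continuous_def by blast+
  have "soft_preimage X (\<lambda>x. g (f x)) G = soft_preimage X f (soft_preimage Y g G)"
    if "G \<in> \<tau>''" for G
    using fm by (auto simp: soft_preimage_def fun_eq_iff)
  then show ?thesis
    using f g fm gm
    by (auto simp: soft_continuous_iff_preimage[OF \<tau> \<tau>'] soft_continuous_iff_preimage[OF \<tau>' \<tau>'']
        soft_continuous_iff_preimage[OF \<tau> \<tau>''])
qed

lemma soft_homeomorphismI:
  assumes f: "soft_continuous E X \<tau> Y \<tau>' f" and g: "soft_continuous E Y \<tau>' X \<tau> g"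
    and gf: "\<And>x. x \<in> X \<Longrightarrow> g (f x) = x" and fg: "\<And>y. y \<in> Y \<Longrightarrow> f (g y) = y"
    and \<tau>: "soft_topology X E \<tau>" and \<tau>': "soft_topology Y E \<tau>'"
  shows "soft_homeomorphism E X \<tau> Y \<tau>' f"
proof -
  have fm: "f \<in> X \<rightarrow> Y" and gm: "g \<in> Y \<rightarrow> X"
    using f g unfolding soft_continuous_def by blast+
  have bij: "bij_betw f X Y" by (rule bij_betwI[OF fm gm gf fg])
  have "inv_into X f y = g y" if "y \<in> Y" for y
    using inv_into_f_eq[OF bij_betw_imp_inj_on[OF bij]] gm fg that by blast
  then have "soft_continuous E Y \<tau>' X \<tau> (inv_into X f)"
    using soft_continuous_cong[OF _ \<tau>' \<tau>] g by blast
  then show ?thesis unfolding soft_homeomorphism_def using bij f by blast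
qed

section \<open>Universal properties of the product and of the pointwise topology\<close>

lemma soft_topology_product: "soft_topology (Pi\<^sub>E S Z) E (soft_product_topology E S Z \<eta>)"
  unfolding soft_product_topology_def by (rule soft_topology_generated)

lemma soft_topology_pointwise:
  "soft_topology (soft_funspace E X \<tau> Y \<tau>') E (soft_pointwise_topology E X \<tau> Y \<tau>')"
  unfolding soft_pointwise_topology_def by (rule soft_topology_generated)

text \<open>
  This presents the product topology as generated by preimages under the projections, which is the
  form that the universal property uses.
\<close>

lemma soft_cylinder_eq_preimage:
  assumes "F \<in> soft_sets (Z t) E" and "t \<in> S"
  shows "(\<lambda>e. Pi\<^sub>E S (\<lambda>s. if s = t then F e else Z s)) = soft_preimage (Pi\<^sub>E S Z) (\<lambda>z. z t) F"
proof
  fix e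
  have "F e \<subseteq> Z t" using assms(1) by (cases "e \<in> E") (auto simp: soft_sets_def)
  then show "Pi\<^sub>E S (\<lambda>s. if s = t then F e else Z s) = soft_preimage (Pi\<^sub>E S Z) (\<lambda>z. z t) F e"
    using assms(2) unfolding soft_preimage_def set_eq_iff PiE_iff mem_Collect_eq
    by (metis subsetD)
qed

lemma soft_preimage_in_soft_sets:
  assumes "G \<in> soft_sets Y E"
  shows "soft_preimage X f G \<in> soft_sets X E"
  using assms by (auto simp: soft_preimage_def soft_sets_def)

lemma soft_continuous_projection:
  assumes \<eta>: "\<And>s. s \<in> S \<Longrightarrow> soft_topology (Z s) E (\<eta> s)" and s: "s \<in> S"
  shows "soft_continuous E (Pi\<^sub>E S Z) (soft_product_topology E S Z \<eta>) (Z s) (\<eta> s) (\<lambda>z. z s)"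
  unfolding soft_continuous_iff_preimage[OF soft_topology_product \<eta>[OF s]]
proof (intro conjI ballI)
  show "(\<lambda>z. z s) \<in> Pi\<^sub>E S Z \<rightarrow> Z s" using s by auto
  define B where "B = {(\<lambda>e. Pi\<^sub>E S (\<lambda>s. if s = s0 then F e else Z s)) | s0 F. s0 \<in> S \<and> F \<in> \<eta> s0}"
  have cyl: "(\<lambda>e. Pi\<^sub>E S (\<lambda>s. if s = s0 then F e else Z s)) = soft_preimage (Pi\<^sub>E S Z) (\<lambda>z. z s0) F"
    if "s0 \<in> S" "F \<in> \<eta> s0" for s0 F
    by (rule soft_cylinder_eq_preimage[where Z = Z and t = s0,
          OF soft_topology_soft_sets[OF \<eta>[OF that(1)] that(2)] that(1)])
  have B: "G \<in> B \<longleftrightarrow> (\<exists>s0\<in>S. \<exists>F\<in>\<eta> s0. G = soft_preimage (Pi\<^sub>E S Z) (\<lambda>z. z s0) F)" for G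
  proof -
    have "G \<in> B \<longleftrightarrow> (\<exists>s0\<in>S. \<exists>F\<in>\<eta> s0. G = (\<lambda>e. Pi\<^sub>E S (\<lambda>s. if s = s0 then F e else Z s)))"
      unfolding B_def mem_Collect_eq by blast
    then show ?thesis by (simp add: cyl cong: bex_cong)
  qed
  have "B \<subseteq> soft_sets (Pi\<^sub>E S Z) E"
  proof
    fix G assume "G \<in> B"
    then obtain s0 F where "s0 \<in> S" "F \<in> \<eta> s0" "G = soft_preimage (Pi\<^sub>E S Z) (\<lambda>z. z s0) F"
      using B by blast
    then show "G \<in> soft_sets (Pi\<^sub>E S Z) E"
      by (simp add: soft_preimage_in_soft_sets[OF soft_topology_soft_sets[OF \<eta>]])
  qed
  then have "B \<subseteq> soft_product_topology E S Z \<eta>"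
    using soft_subbase_generated
    unfolding soft_product_topology_def B_def[symmetric] soft_subbase_def by metis
  moreover fix F assume "F \<in> \<eta> s"
  ultimately show "soft_preimage (Pi\<^sub>E S Z) (\<lambda>z. z s) F \<in> soft_product_topology E S Z \<eta>"
    using B s by blast
qed

text \<open>
  The preimage under \<open>f\<close> of a subbasic cylinder is the preimage under a component of \<open>f\<close> of a soft
  open set of the factor.
\<close>

lemma soft_continuous_into_product:
  assumes \<eta>: "\<And>s. s \<in> S \<Longrightarrow> soft_topology (Z s) E (\<eta> s)"
    and \<sigma>: "soft_topology W E \<sigma>" and f: "f \<in> W \<rightarrow> Pi\<^sub>E S Z"
    and comp: "\<And>s. s \<in> S \<Longrightarrow> soft_continuous E W \<sigma> (Z s) (\<eta> s) (\<lambda>w. f w s)"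
  shows "soft_continuous E W \<sigma> (Pi\<^sub>E S Z) (soft_product_topology E S Z \<eta>) f"
  unfolding soft_product_topology_def
proof (rule soft_continuous_into_generated[OF \<sigma> f])
  fix G assume "G \<in> {(\<lambda>e. Pi\<^sub>E S (\<lambda>s. if s = s0 then F e else Z s)) | s0 F. s0 \<in> S \<and> F \<in> \<eta> s0}"
  then obtain s F where s: "s \<in> S" and F: "F \<in> \<eta> s"
    and "G = (\<lambda>e. Pi\<^sub>E S (\<lambda>t. if t = s then F e else Z t))" by blast
  then have "G = soft_preimage (Pi\<^sub>E S Z) (\<lambda>z. z s) F"
    using soft_cylinder_eq_preimage[where Z = Z and t = s,
        OF soft_topology_soft_sets[OF \<eta>[OF s] F] s] by simp
  then have "soft_preimage W f G = soft_preimage W (\<lambda>w. f w s) F"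
    using f by (auto simp: soft_preimage_def fun_eq_iff)
  then show "soft_preimage W f G \<in> \<sigma>"
    using comp[OF s] F unfolding soft_continuous_iff_preimage[OF \<sigma> \<eta>[OF s]] by simp
qed

lemma soft_continuous_eval:
  assumes \<tau>': "soft_topology Y E \<tau>'" and x: "x \<in> X"
  shows "soft_continuous E (soft_funspace E X \<tau> Y \<tau>') (soft_pointwise_topology E X \<tau> Y \<tau>') Y \<tau>'
    (\<lambda>f. f x)"
proof (cases "E = {}")
  \<comment> \<open>Without parameters there are no soft points, so the subbase of the pointwise topology is empty
    and continuity is vacuous.\<close>
  case True
  then show ?thesis using x by (auto simp: soft_continuous_def soft_funspace_def)
next
  case False
  then obtain \<alpha> where \<alpha>: "\<alpha> \<in> E" by blast
  let ?M = "soft_funspace E X \<tau> Y \<tau>'"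
  let ?B = "{soft_preimage ?M (soft_eval x \<alpha>) G | x \<alpha> G. x \<in> X \<and> \<alpha> \<in> E \<and> G \<in> \<tau>'}"
  show ?thesis
    unfolding soft_continuous_iff_preimage[OF soft_topology_pointwise \<tau>']
  proof (intro conjI ballI)
    show "(\<lambda>f. f x) \<in> ?M \<rightarrow> Y" using x by (auto simp: soft_funspace_def)
    have "?B \<subseteq> soft_sets ?M E"
      using soft_preimage_in_soft_sets soft_topology_soft_sets[OF \<tau>'] by blast
    then have "?B \<subseteq> soft_pointwise_topology E X \<tau> Y \<tau>'"
      using soft_subbase_generated unfolding soft_pointwise_topology_def soft_subbase_def by blast
    moreover fix G assume "G \<in> \<tau>'"
    then have "soft_preimage ?M (soft_eval x \<alpha>) G \<in> ?B" using x \<alpha> by blast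
    ultimately show "soft_preimage ?M (\<lambda>f. f x) G \<in> soft_pointwise_topology E X \<tau> Y \<tau>'"
      unfolding soft_eval_def by blast
  qed
qed

text \<open>
  The same argument as for the product, with evaluations in place of projections. That \<open>f\<close> takes
  values in the function space is a separate hypothesis: continuity of \<open>w \<mapsto> f w x\<close> for each \<open>x\<close> says
  nothing about continuity of \<open>x \<mapsto> f w x\<close>.
\<close>

lemma soft_continuous_into_pointwise:
  assumes \<tau>': "soft_topology Y E \<tau>'" and \<sigma>: "soft_topology W E \<sigma>"
    and f: "f \<in> W \<rightarrow> soft_funspace E X \<tau> Y \<tau>'"
    and comp: "\<And>x. x \<in> X \<Longrightarrow> soft_continuous E W \<sigma> Y \<tau>' (\<lambda>w. f w x)"
  shows "soft_continuous E W \<sigma>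
    (soft_funspace E X \<tau> Y \<tau>') (soft_pointwise_topology E X \<tau> Y \<tau>') f"
  unfolding soft_pointwise_topology_def
proof (rule soft_continuous_into_generated[OF \<sigma> f])
  let ?M = "soft_funspace E X \<tau> Y \<tau>'"
  fix H assume "H \<in> {soft_preimage ?M (soft_eval x \<alpha>) G | x \<alpha> G. x \<in> X \<and> \<alpha> \<in> E \<and> G \<in> \<tau>'}"
  then obtain x \<alpha> G where x: "x \<in> X" and "\<alpha> \<in> E" and G: "G \<in> \<tau>'"
    and H: "H = soft_preimage ?M (soft_eval x \<alpha>) G" by blast
  have "soft_preimage W f H = soft_preimage W (\<lambda>w. f w x) G"
    using f unfolding H by (auto simp: soft_preimage_def soft_eval_def fun_eq_iff)
  then show "soft_preimage W f H \<in> \<sigma>"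
    using comp[OF x] G unfolding soft_continuous_iff_preimage[OF \<sigma> \<tau>'] by simp
qed

section \<open>The exchange of arguments\<close>

text \<open>
  The next two lemmas are the two directions of the correspondence between soft continuous maps into
  the product and families of soft continuous maps into the factors.
\<close>

lemma soft_Delta_in_funspace:
  assumes \<tau>: "soft_topology X E \<tau>" and \<tau>': "\<And>s. s \<in> S \<Longrightarrow> soft_topology (Y s) E (\<tau>' s)"
    and f: "f \<in> Pi\<^sub>E S (\<lambda>s. soft_funspace E X \<tau> (Y s) (\<tau>' s))"
  shows "soft_Delta X S f \<in> soft_funspace E X \<tau> (Pi\<^sub>E S Y) (soft_product_topology E S Y \<tau>')"
proof -
  have fs: "f s \<in> X \<rightarrow>\<^sub>E Y s" "soft_continuous E X \<tau> (Y s) (\<tau>' s) (f s)" if "s \<in> S" for s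
    using f that unfolding soft_funspace_def by (auto simp: PiE_iff)
  have maps: "soft_Delta X S f \<in> X \<rightarrow>\<^sub>E Pi\<^sub>E S Y"
    using PiE_mem[OF fs(1)] by (auto simp: soft_Delta_def)
  moreover have "soft_continuous E X \<tau> (Pi\<^sub>E S Y) (soft_product_topology E S Y \<tau>') (soft_Delta X S f)"
  proof (rule soft_continuous_into_product[OF \<tau>' \<tau>])
    show "soft_Delta X S f \<in> X \<rightarrow> Pi\<^sub>E S Y" using maps by auto
    fix s assume s: "s \<in> S"
    have "soft_continuous E X \<tau> (Y s) (\<tau>' s) (\<lambda>x. soft_Delta X S f x s) \<longleftrightarrow>
      soft_continuous E X \<tau> (Y s) (\<tau>' s) (f s)"
      by (rule soft_continuous_cong[OF _ \<tau> \<tau>'[OF s]]) (simp add: soft_Delta_def s)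
    then show "soft_continuous E X \<tau> (Y s) (\<tau>' s) (\<lambda>x. soft_Delta X S f x s)"
      using fs(2)[OF s] by blast
  qed
  ultimately show ?thesis unfolding soft_funspace_def by blast
qed

lemma soft_component_in_funspace:
  assumes \<tau>: "soft_topology X E \<tau>" and \<tau>': "\<And>s. s \<in> S \<Longrightarrow> soft_topology (Y s) E (\<tau>' s)"
    and g: "g \<in> soft_funspace E X \<tau> (Pi\<^sub>E S Y) (soft_product_topology E S Y \<tau>')" and s: "s \<in> S"
  shows "(\<lambda>x\<in>X. g x s) \<in> soft_funspace E X \<tau> (Y s) (\<tau>' s)"
proof -
  have gm: "g \<in> X \<rightarrow>\<^sub>E Pi\<^sub>E S Y"
    and gc: "soft_continuous E X \<tau> (Pi\<^sub>E S Y) (soft_product_topology E S Y \<tau>') g"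
    using g unfolding soft_funspace_def by blast+
  have "soft_continuous E X \<tau> (Y s) (\<tau>' s) (\<lambda>x. g x s)"
    by (rule soft_continuous_compose[OF gc soft_continuous_projection[OF \<tau>' s] \<tau>
          soft_topology_product \<tau>'[OF s]])
  moreover have "soft_continuous E X \<tau> (Y s) (\<tau>' s) (\<lambda>x\<in>X. g x s) \<longleftrightarrow>
    soft_continuous E X \<tau> (Y s) (\<tau>' s) (\<lambda>x. g x s)"
    by (rule soft_continuous_cong[OF _ \<tau> \<tau>'[OF s]]) simp
  moreover have "(\<lambda>x\<in>X. g x s) \<in> X \<rightarrow>\<^sub>E Y s" using gm s by fastforce
  ultimately show ?thesis unfolding soft_funspace_def by blast
qed

theorem theorem6:
  fixes E :: "'e set"
    and X :: "'a set" and \<tau> :: "('e, 'a) soft set"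
    and S :: "'s set" and Y :: "'s \<Rightarrow> 'b set" and \<tau>' :: "'s \<Rightarrow> ('e, 'b) soft set"
  assumes "soft_topology X E \<tau>"
    and "\<And>s. s \<in> S \<Longrightarrow> soft_topology (Y s) E (\<tau>' s)"
  shows "soft_homeomorphism E
    (Pi\<^sub>E S (\<lambda>s. soft_funspace E X \<tau> (Y s) (\<tau>' s)))
    (soft_product_topology E S
      (\<lambda>s. soft_funspace E X \<tau> (Y s) (\<tau>' s))
      (\<lambda>s. soft_pointwise_topology E X \<tau> (Y s) (\<tau>' s)))
    (soft_funspace E X \<tau> (Pi\<^sub>E S Y) (soft_product_topology E S Y \<tau>'))
    (soft_pointwise_topology E X \<tau> (Pi\<^sub>E S Y) (soft_product_topology E S Y \<tau>'))
    (soft_Delta X S)"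
proof -
  note \<tau> = assms(1) and \<tau>' = assms(2)
  define L where "L = Pi\<^sub>E S (\<lambda>s. soft_funspace E X \<tau> (Y s) (\<tau>' s))"
  define \<kappa> where "\<kappa> = soft_product_topology E S
    (\<lambda>s. soft_funspace E X \<tau> (Y s) (\<tau>' s)) (\<lambda>s. soft_pointwise_topology E X \<tau> (Y s) (\<tau>' s))"
  define R where "R = soft_funspace E X \<tau> (Pi\<^sub>E S Y) (soft_product_topology E S Y \<tau>')"
  define \<rho> where "\<rho> = soft_pointwise_topology E X \<tau> (Pi\<^sub>E S Y) (soft_product_topology E S Y \<tau>')"
  \<comment> \<open>The inverse of \<open>\<Delta>\<close>. Both restrictions are needed: they give the values \<open>undefined\<close> outside \<open>S\<close>
    and \<open>X\<close> that the extensional elements of \<open>L\<close> have there.\<close>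
  define \<Gamma> where "\<Gamma> = (\<lambda>g. \<lambda>s\<in>S. \<lambda>x\<in>X. g x s :: 'b)"
  have top_L: "soft_topology L E \<kappa>" unfolding L_def \<kappa>_def by (rule soft_topology_product)
  have top_R: "soft_topology R E \<rho>" unfolding R_def \<rho>_def by (rule soft_topology_pointwise)
  have Delta_maps: "soft_Delta X S \<in> L \<rightarrow> R"
    unfolding L_def R_def by (rule funcsetI) (rule soft_Delta_in_funspace[OF \<tau> \<tau>'])
  have Gamma_maps: "\<Gamma> \<in> R \<rightarrow> L"
    unfolding L_def R_def \<Gamma>_def
    by (intro funcsetI restrict_PiE_iff[THEN iffD2] ballI soft_component_in_funspace[OF \<tau> \<tau>'])
  \<comment> \<open>Reduce along the evaluations and then the projections; what is left is \<open>f \<mapsto> f s x\<close>, a projection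
    followed by an evaluation.\<close>
  have Delta_cont: "soft_continuous E L \<kappa> R \<rho> (soft_Delta X S)"
    unfolding R_def \<rho>_def
  proof (rule soft_continuous_into_pointwise[OF soft_topology_product top_L
        Delta_maps[unfolded R_def]])
    fix x assume x: "x \<in> X"
    show "soft_continuous E L \<kappa> (Pi\<^sub>E S Y) (soft_product_topology E S Y \<tau>')
      (\<lambda>f. soft_Delta X S f x)"
    proof (rule soft_continuous_into_product[OF \<tau>' top_L])
      have "soft_Delta X S f x \<in> Pi\<^sub>E S Y" if "f \<in> L" for f
      proof -
        have "soft_Delta X S f \<in> X \<rightarrow>\<^sub>E Pi\<^sub>E S Y"
          using funcset_mem[OF Delta_maps that] by (simp add: R_def soft_funspace_def)
        then show ?thesis using x by (rule PiE_mem)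
      qed
      then show "(\<lambda>f. soft_Delta X S f x) \<in> L \<rightarrow> Pi\<^sub>E S Y" by (rule funcsetI)
      fix s assume s: "s \<in> S"
      have "soft_continuous E L \<kappa> (Y s) (\<tau>' s) (\<lambda>f. f s x)"
        unfolding L_def \<kappa>_def
        by (rule soft_continuous_compose[OF
              soft_continuous_projection[
                where Z = "\<lambda>s. soft_funspace E X \<tau> (Y s) (\<tau>' s)"
                  and \<eta> = "\<lambda>s. soft_pointwise_topology E X \<tau> (Y s) (\<tau>' s)",
                OF soft_topology_pointwise s]
              soft_continuous_eval[OF \<tau>'[OF s] x] soft_topology_product
              soft_topology_pointwise \<tau>'[OF s]])
      then show "soft_continuous E L \<kappa> (Y s) (\<tau>' s) (\<lambda>f. soft_Delta X S f x s)"
        using x s by (simp add: soft_Delta_def)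
    qed
  qed
  \<comment> \<open>Here the reductions come in the opposite order, and leave an evaluation followed by a
    projection.\<close>
  have Gamma_cont: "soft_continuous E R \<rho> L \<kappa> \<Gamma>"
    unfolding L_def \<kappa>_def
  proof (rule soft_continuous_into_product[OF soft_topology_pointwise top_R
        Gamma_maps[unfolded L_def]])
    fix s assume s: "s \<in> S"
    show "soft_continuous E R \<rho> (soft_funspace E X \<tau> (Y s) (\<tau>' s))
      (soft_pointwise_topology E X \<tau> (Y s) (\<tau>' s)) (\<lambda>g. \<Gamma> g s)"
    proof (rule soft_continuous_into_pointwise[OF \<tau>'[OF s] top_R])
      show "(\<lambda>g. \<Gamma> g s) \<in> R \<rightarrow> soft_funspace E X \<tau> (Y s) (\<tau>' s)"
        using PiE_mem[OF funcset_mem[OF Gamma_maps[unfolded L_def]] s] by (rule funcsetI)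
      fix x assume x: "x \<in> X"
      have "soft_continuous E R \<rho> (Y s) (\<tau>' s) (\<lambda>g. g x s)"
        unfolding R_def \<rho>_def
        by (rule soft_continuous_compose[OF soft_continuous_eval[OF soft_topology_product x]
              soft_continuous_projection[where Z = Y and \<eta> = \<tau>', OF \<tau>' s]
              soft_topology_pointwise
              soft_topology_product \<tau>'[OF s]])
      then show "soft_continuous E R \<rho> (Y s) (\<tau>' s) (\<lambda>g. \<Gamma> g s x)"
        using x s by (simp add: \<Gamma>_def)
    qed
  qed
  have "\<Gamma> (soft_Delta X S f) = f" if "f \<in> L" for f
  proof -
    have fs: "f s \<in> X \<rightarrow>\<^sub>E Y s" if "s \<in> S" for s
      using PiE_mem[OF \<open>f \<in> L\<close>[unfolded L_def] that] by (simp add: soft_funspace_def)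
    have "\<Gamma> (soft_Delta X S f) s x = f s x" if "s \<in> S" for s x
      using PiE_arb[OF fs[OF that], of x] that
      by (cases "x \<in> X") (simp_all add: \<Gamma>_def soft_Delta_def)
    then have "\<Gamma> (soft_Delta X S f) s = f s" if "s \<in> S" for s
      using that by (intro ext) simp
    moreover have "\<Gamma> (soft_Delta X S f) s = f s" if "s \<notin> S" for s
      using PiE_arb[OF \<open>f \<in> L\<close>[unfolded L_def] that] that by (simp add: \<Gamma>_def)
    ultimately show ?thesis by (intro ext) metis
  qed
  moreover have "soft_Delta X S (\<Gamma> g) = g" if "g \<in> R" for g
  proof -
    have gm: "g \<in> X \<rightarrow>\<^sub>E Pi\<^sub>E S Y" using that unfolding R_def soft_funspace_def by blast
    have "soft_Delta X S (\<Gamma> g) x s = g x s" if "x \<in> X" for x s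
      using PiE_arb[OF PiE_mem[OF gm that], of s] that
      by (cases "s \<in> S") (simp_all add: \<Gamma>_def soft_Delta_def)
    then have "soft_Delta X S (\<Gamma> g) x = g x" if "x \<in> X" for x
      using that by (intro ext) simp
    moreover have "soft_Delta X S (\<Gamma> g) x = g x" if "x \<notin> X" for x
      using PiE_arb[OF gm that] that by (simp add: soft_Delta_def)
    ultimately show ?thesis by (intro ext) metis
  qed
  ultimately have "soft_homeomorphism E L \<kappa> R \<rho> (soft_Delta X S)"
    by (rule soft_homeomorphismI[OF Delta_cont Gamma_cont _ _ top_L top_R])
  then show ?thesis unfolding L_def \<kappa>_def R_def \<rho>_def .
qed

end
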